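(* Suppose $W$ and $V$ are infinite dimensional. Let $(X_n)_{n\in\mathbb N}$ be a sequence of finite dimensional subspaces of $X$ satisfying AS and DF. Then the spaces can be augmented by one vector so as to still satisfy AS and DF but not DC: there exist vectors $u_n\in X\setminus X_n$ ($n\in\mathbb N$) such that the sequence of spaces $\tilde X_n=X_n\oplus\mathbb R u_n$ satisfies AS and DF but does not satisfy DC.
   Context: Setting. $O$ is an infinite dimensional separable real Hilbert space with scalar product $\langle\cdot,\cdot\rangle$ and norm $|\cdot|$. $X\subseteq O$ is a dense subspace, itself a Hilbert space with continuous inclusion $X\to O$. $a$ is a continuous symmetric bilinear form on $X$ with $a(u,u)\ge 0$ for all $u\in X$, such that $\langle\cdot,\cdot\rangle+a$ is coercive on $X$; this form is taken as the scalar product of $X$, so $\|u\|^2=|u|^2+a(u,u)$ is the norm of $X$. Define $W=\{u\in X: a(u,u')=0\ \forall u'\in X\}$ and $V=\{u\in X:\langle u,w\rangle=0\ \forall w\in W\}$, so $X=V\oplus W$. It is assumed that the injection $V\to O$ is compact ($V$ carrying the norm of $X$). Conditions. For a sequence $(Y_n)_{n\in\mathbb N}$ of finite dimensional subspaces of $X$, put $W_n=Y_n\cap W=\{u\in Y_n:a(u,u')=0\ \forall u'\in Y_n\}$ and $V_n=\{u\in Y_n:\langle u,w\rangle=0\ \forall w\in W_n\}$. The sequence $(Y_n)$ satisfies: AS if for all $u\in X$, $\lim_{n\to\infty}\inf_{u'\in Y_n}\|u-u'\|=0$; DF if there is $C>0$ such that $|v|^2\le C\,a(v,v)$ for all $n$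 and all $v\in V_n$; DC if for every infinite $N\subseteq\mathbb N$ and every family $(v_n)_{n\in N}$ with $v_n\in V_n$ that is bounded in $X$, there is a subsequence converging strongly in $O$ to an element of $V$. *)

theory Defs
  imports "HOL-Analysis.Analysis"
begin

definition fin_dim :: "'a::real_vector set \<Rightarrow> bool" where
  "fin_dim S \<longleftrightarrow> (\<exists>B. finite B \<and> S \<subseteq> span B)"

text \<open>
  The Hilbert spaces \<open>O\<close> and \<open>X\<close> are types \<open>'o\<close> and \<open>'x\<close>; the inclusion of \<open>X\<close> in \<open>O\<close> is an
  injective bounded linear map \<open>j\<close>. Thus \<open>norm\<close> on \<open>'x\<close> is the norm of \<open>X\<close>, while
  \<open>norm (j u)\<close> is the norm of \<open>u\<close> as an element of \<open>O\<close>.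
\<close>

definition W_space :: "('x::real_inner \<Rightarrow> 'x \<Rightarrow> real) \<Rightarrow> 'x set" where
  "W_space a = {u. \<forall>u'. a u u' = 0}"

definition V_space :: "('x::real_inner \<Rightarrow> 'o::real_inner) \<Rightarrow> ('x \<Rightarrow> 'x \<Rightarrow> real) \<Rightarrow> 'x set" where
  "V_space j a = {u. \<forall>w\<in>W_space a. j u \<bullet> j w = 0}"

locale hilbert_setting =
  fixes j :: "'x::{real_inner,complete_space} \<Rightarrow> 'o::{real_inner,complete_space}"
    and a :: "'x \<Rightarrow> 'x \<Rightarrow> real"
  assumes O_infinite_dim: "\<not> fin_dim (UNIV :: 'o set)"
    and O_separable: "\<exists>D :: 'o set. countable D \<and> closure D = UNIV"
    and j_bounded_linear: "bounded_linear j"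
    and j_inj: "inj j"
    and j_dense: "closure (range j) = UNIV"
    and a_bounded_bilinear: "bounded_bilinear a"
    and a_sym: "a u v = a v u"
    and a_nonneg: "0 \<le> a u u"
    and inner_X: "u \<bullet> v = j u \<bullet> j v + a u v"
    and V_compact: "compact (closure (j ` {v \<in> V_space j a. norm v \<le> 1}))"

definition discrete_W :: "('x::real_inner \<Rightarrow> 'x \<Rightarrow> real) \<Rightarrow> 'x set \<Rightarrow> 'x set" where
  "discrete_W a Y = Y \<inter> W_space a"

definition discrete_V ::
    "('x::real_inner \<Rightarrow> 'o::real_inner) \<Rightarrow> ('x \<Rightarrow> 'x \<Rightarrow> real) \<Rightarrow> 'x set \<Rightarrow> 'x set" where
  "discrete_V j a Y = {u \<in> Y. \<forall>w\<in>discrete_W a Y. j u \<bullet> j w = 0}"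

definition AS :: "(nat \<Rightarrow> 'x::real_inner set) \<Rightarrow> bool" where
  "AS Y \<longleftrightarrow> (\<forall>u. (\<lambda>n. INF u'\<in>Y n. norm (u - u')) \<longlonglongrightarrow> 0)"

definition DF ::
    "('x::real_inner \<Rightarrow> 'o::real_inner) \<Rightarrow> ('x \<Rightarrow> 'x \<Rightarrow> real) \<Rightarrow> (nat \<Rightarrow> 'x set) \<Rightarrow> bool" where
  "DF j a Y \<longleftrightarrow> (\<exists>C>0. \<forall>n. \<forall>v\<in>discrete_V j a (Y n). (norm (j v))\<^sup>2 \<le> C * a v v)"

definition DC ::
    "('x::real_inner \<Rightarrow> 'o::real_inner) \<Rightarrow> ('x \<Rightarrow> 'x \<Rightarrow> real) \<Rightarrow> (nat \<Rightarrow> 'x set) \<Rightarrow> bool" where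
  "DC j a Y \<longleftrightarrow>
    (\<forall>N v. infinite N \<and> (\<forall>n\<in>N. v n \<in> discrete_V j a (Y n)) \<and> bounded (v ` N) \<longrightarrow>
      (\<exists>r. strict_mono r \<and> range r \<subseteq> N \<and>
        (\<exists>v\<^sub>0\<in>V_space j a. (\<lambda>k. j (v (r k))) \<longlonglongrightarrow> j v\<^sub>0)))"

definition augment :: "'x::real_vector set \<Rightarrow> 'x \<Rightarrow> 'x set" where
  "augment Y u = {x + t *\<^sub>R u | x t. x \<in> Y}"

end

theory Submission imports Defs begin

text \<open>
  Take \<open>u\<^sub>n = w\<^sub>n + z\<^sub>n\<close> with \<open>w\<^sub>n \<in> W\<close> a unit vector orthogonal to \<open>X\<^sub>n\<close>, and \<open>z\<^sub>n \<in> V\<close> with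
  \<open>a(z\<^sub>n, z\<^sub>n) = 1\<close> that is \<open>a\<close>-orthogonal to \<open>X\<^sub>n\<close>. The component \<open>z\<^sub>n\<close> prevents \<open>u\<^sub>n\<close> from
  enlarging the discrete kernel, so the new discrete \<open>V\<close>-space is the old one plus \<open>\<real>u\<^sub>n\<close>; since
  \<open>a(x + t u\<^sub>n, x + t u\<^sub>n) = a(x, x) + t\<^sup>2\<close>, DF is kept. The inequality \<open>|v|\<^sup>2 \<le> P a(v, v)\<close> on \<open>V\<close>
  bounds \<open>u\<^sub>n\<close> in \<open>X\<close>. Finally \<open>\<langle>u\<^sub>n, w\<^sub>n\<rangle> = 1\<close>, whereas \<open>\<langle>v, w\<^sub>n\<rangle> = 0\<close> for all \<open>v \<in> V\<close>, so no
  subsequence of \<open>u\<^sub>n\<close> converges in \<open>O\<close> to an element of \<open>V\<close>.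
\<close>

section \<open>Linear algebra: infinite dimensional subspaces cut by finitely many
  functionals\<close>

lemma not_fin_dim_kernel:
  fixes S :: "'a::real_vector set" and f :: "'a \<Rightarrow> real"
  assumes S: "subspace S" "\<not> fin_dim S" and f: "linear f"
  shows "\<not> fin_dim {s \<in> S. f s = 0}"
proof
  assume "fin_dim {s \<in> S. f s = 0}"
  then obtain B where B: "finite B" "{s \<in> S. f s = 0} \<subseteq> span B"
    unfolding fin_dim_def by blast
  show False
  proof (cases "\<forall>s\<in>S. f s = 0")
    case True
    then have "S \<subseteq> span B" using B by blast
    then show False using S B unfolding fin_dim_def by blast
  next
    case False
    then obtain s0 where s0: "s0 \<in> S" "f s0 \<noteq> 0" by blast
    have "s \<in> span (insert s0 B)" if "s \<in> S" for s
    proof -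
      have "s - (f s / f s0) *\<^sub>R s0 \<in> {s \<in> S. f s = 0}"
        using that s0 S(1)
        by (simp add: subspace_diff subspace_scale linear_diff[OF f] linear_scale[OF f])
      then show ?thesis using B(2) unfolding span_insert by blast
    qed
    then show False using S(2) B(1) unfolding fin_dim_def
      by (metis finite_insert subsetI)
  qed
qed

text \<open>Vanishing on a finite set \<open>B\<close> that spans \<open>Y\<close> suffices, and
  imposing one functional at a time keeps the dimension infinite. It serves with \<open>g\<close>
  the scalar product of \<open>O\<close> and with \<open>g\<close> the form
  \<open>a\<close>.\<close>

lemma ex_nonzero_common_kernel:
  fixes S Y :: "'a::real_vector set" and g :: "'a \<Rightarrow> 'a \<Rightarrow> real"
  assumes S: "subspace S" "\<not> fin_dim S" and Y: "fin_dim Y"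
    and g1: "\<And>y. linear (\<lambda>s. g s y)" and g2: "\<And>s. linear (g s)"
  obtains s where "s \<in> S" "s \<noteq> 0" "\<And>y. y \<in> Y \<Longrightarrow> g s y = 0"
proof -
  obtain B where B: "finite B" "Y \<subseteq> span B"
    using Y unfolding fin_dim_def by blast
  define K where "K = (\<lambda>B. {s \<in> S. \<forall>b\<in>B. g s b = 0})"
  have "subspace (K B) \<and> \<not> fin_dim (K B)"
    using B(1)
  proof (induction B rule: finite_induct)
    case empty
    then show ?case using S by (simp add: K_def)
  next
    case (insert b F)
    have eq: "K (insert b F) = {s \<in> K F. g s b = 0}"
      by (auto simp: K_def)
    have "subspace (K (insert b F))"
      using insert.IH unfolding eq subspace_def
      by (auto simp: linear_add[OF g1] linear_scale[OF g1] linear_0[OF g1])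
    moreover have "\<not> fin_dim (K (insert b F))"
      unfolding eq by (rule not_fin_dim_kernel) (use insert.IH g1 in auto)
    ultimately show ?case by blast
  qed
  \<comment> \<open>Since \<open>span {}\<close> is zero, testing the empty spanning set already
    yields a nonzero vector.\<close>
  then have "\<not> K B \<subseteq> span {}"
    unfolding fin_dim_def by blast
  then obtain s where s: "s \<in> K B" "s \<noteq> 0" by auto
  have "g s y = 0" if "y \<in> Y" for y
  proof (rule linear_eq_0_on_span[OF g2])
    show "y \<in> span B" using that B(2) by blast
  qed (use s(1) in \<open>auto simp: K_def\<close>)
  with s show ?thesis using that by (auto simp: K_def)
qed

lemma subset_augment: "Y \<subseteq> augment Y u"
  unfolding augment_def by (force intro: exI[of _ "0::real"])

text \<open>The distance to a larger space is smaller. Nonemptiness keeps the infima genuine, with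
  lower bound 0.\<close>

lemma AS_mono:
  assumes "AS Y" and "\<And>n. Y n \<noteq> {}" and sub: "\<And>n. Y n \<subseteq> Z n"
  shows "AS Z"
  unfolding AS_def
proof
  fix u
  have bdd: "bdd_below ((\<lambda>u'. norm (u - u')) ` Z n)" for n
    by (rule bdd_belowI[of _ 0]) auto
  show "(\<lambda>n. INF u'\<in>Z n. norm (u - u')) \<longlonglongrightarrow> 0"
  proof (rule tendsto_sandwich[OF _ _ tendsto_const])
    show "(\<lambda>n. INF u'\<in>Y n. norm (u - u')) \<longlonglongrightarrow> 0"
      using assms(1) unfolding AS_def by blast
    show "\<forall>\<^sub>F n in sequentially. 0 \<le> (INF u'\<in>Z n. norm (u - u'))"
      using assms(2) sub by (intro always_eventually allI cINF_greatest) auto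
    show "\<forall>\<^sub>F n in sequentially. (INF u'\<in>Z n. norm (u - u')) \<le> (INF u'\<in>Y n. norm (u - u'))"
      using assms(2) sub bdd by (intro always_eventually allI cINF_superset_mono) auto
  qed
qed

section \<open>The form \<open>a\<close> on \<open>V\<close> and \<open>W\<close>, and a Poincare
  inequality on \<open>V\<close>\<close>

context hilbert_setting
begin

lemma linear_j: "linear j"
  by (rule bounded_linear.linear[OF j_bounded_linear])

lemmas a_simps =
  bounded_bilinear.add_left[OF a_bounded_bilinear]
  bounded_bilinear.add_right[OF a_bounded_bilinear]
  bounded_bilinear.diff_left[OF a_bounded_bilinear]
  bounded_bilinear.diff_right[OF a_bounded_bilinear]
  bounded_bilinear.scaleR_left[OF a_bounded_bilinear]
  bounded_bilinear.scaleR_right[OF a_bounded_bilinear]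
  bounded_bilinear.zero_left[OF a_bounded_bilinear]
  bounded_bilinear.zero_right[OF a_bounded_bilinear]

lemmas j_simps = linear_add[OF linear_j] linear_diff[OF linear_j] linear_scale[OF linear_j]
  linear_0[OF linear_j]

lemma linear_a_left: "linear (\<lambda>u. a u v)"
  by (rule linearI) (simp_all add: a_simps)

lemma linear_a_right: "linear (a u)"
  by (rule linearI) (simp_all add: a_simps)

lemma norm_X: "(norm u)\<^sup>2 = (norm (j u))\<^sup>2 + a u u"
  using inner_X[of u u] by (simp add: power2_norm_eq_inner)

lemma subspace_W: "subspace (W_space a)"
  unfolding subspace_def W_space_def by (simp add: a_simps)

lemma subspace_V: "subspace (V_space j a)"
  unfolding subspace_def V_space_def by (simp add: j_simps inner_add_left)

lemma V_inner_W: "v \<in> V_space j a \<Longrightarrow> w \<in> W_space a \<Longrightarrow> j v \<bullet> j w = 0"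
  by (simp add: V_space_def)

lemma a_W: "w \<in> W_space a \<Longrightarrow> a w u = 0" "w \<in> W_space a \<Longrightarrow> a u w = 0"
  using a_sym by (auto simp: W_space_def)

text \<open>A vector isotropic for a nonnegative symmetric form lies in its radical; otherwise
  moving along \<open>v\<close> makes the form negative.\<close>

lemma W_space_iff: "u \<in> W_space a \<longleftrightarrow> a u u = 0"
proof
  assume u: "a u u = 0"
  have "a u v = 0" for v
  proof (rule ccontr)
    assume nz: "a u v \<noteq> 0"
    \<comment> \<open>Nearly the minimiser of \<open>2 * t * a u v + t\<^sup>2 * a v v\<close>; the
      added 1 covers \<open>a v v = 0\<close>.\<close>
    define t where "t = - a u v / (a v v + 1)"
    have pos: "a v v + 1 > 0" using a_nonneg[of v] by simp
    have "a (u + t *\<^sub>R v) (u + t *\<^sub>R v) = t * (2 * a u v + t * a v v)"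
      using u a_sym[of v u] by (simp add: a_simps algebra_simps)
    also have "\<dots> = - (a u v)\<^sup>2 * (a v v + 2) / (a v v + 1)\<^sup>2"
      using pos by (simp add: t_def divide_simps power2_eq_square) (simp add: algebra_simps)
    also have "\<dots> < 0"
      using nz pos a_nonneg[of v] by (simp add: divide_neg_pos zero_less_mult_iff)
    finally show False using a_nonneg[of "u + t *\<^sub>R v"] by simp
  qed
  then show "u \<in> W_space a" by (simp add: W_space_def)
qed (simp add: W_space_def)

lemma V_Int_W: "v \<in> V_space j a \<Longrightarrow> v \<in> W_space a \<Longrightarrow> v = 0"
  using inner_X[of v v] by (simp add: V_inner_W a_W)

lemma closed_V: "closed (V_space j a)"
proof -
  have eq: "V_space j a = (\<Inter>w\<in>W_space a. {u. j u \<bullet> j w = 0})"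
    by (auto simp: V_space_def)
  have "continuous_on UNIV j"
    by (rule linear_continuous_on[OF j_bounded_linear])
  then show ?thesis unfolding eq
    by (intro closed_INT ballI closed_Collect_eq continuous_intros)
qed

text \<open>Parallelogram law with the nonnegative term at \<open>u + v\<close> dropped.\<close>

lemma a_diff_le: "a (u - v) (u - v) \<le> 2 * a u u + 2 * a v v"
  using a_nonneg[of "u + v"] by (simp add: a_simps)

text \<open>
  If it fails, there are unit vectors of \<open>V\<close> with \<open>a(v, v) \<rightarrow> 0\<close>; by compactness a subsequence
  converges in \<open>O\<close>, hence in \<open>X\<close>, to a unit vector of \<open>V \<inter> W\<close>.
\<close>
lemma poincare_V: "\<exists>P>0. \<forall>v\<in>V_space j a. (norm (j v))\<^sup>2 \<le> P * a v v"
proof (rule ccontr)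
  assume "\<not> ?thesis"
  then have neg: "\<exists>v\<in>V_space j a. P * a v v < (norm (j v))\<^sup>2" if "P > 0" for P
    using that by (meson not_le)
  have "\<exists>v\<in>V_space j a. norm v = 1 \<and> a v v \<le> 1 / real (Suc n)" for n
  proof -
    obtain v where v: "v \<in> V_space j a" "real (Suc n) * a v v < (norm (j v))\<^sup>2"
      using neg[of "real (Suc n)"] by auto
    have v0: "norm v > 0" using v(2) by (auto simp: j_simps a_simps)
    have "real (Suc n) * a v v \<le> (norm v)\<^sup>2"
      using v(2) norm_X[of v] a_nonneg[of v] by simp
    then have "a v v / (norm v)\<^sup>2 \<le> 1 / real (Suc n)"
      using v0 by (simp add: field_simps)
    then show ?thesis using v0 v(1)
      by (intro bexI[of _ "(1 / norm v) *\<^sub>R v"])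
        (auto simp: a_simps power2_eq_square subspace_scale[OF subspace_V])
  qed
  then obtain f where f: "\<And>n. f n \<in> V_space j a" "\<And>n. norm (f n) = 1"
      "\<And>n. a (f n) (f n) \<le> 1 / real (Suc n)"
    by metis
  have "j (f n) \<in> closure (j ` {v \<in> V_space j a. norm v \<le> 1})" for n
    using f by (intro subsetD[OF closure_subset] imageI) simp
  then obtain l r where r: "strict_mono r" and l: "((\<lambda>n. j (f n)) \<circ> r) \<longlonglongrightarrow> l"
    using V_compact unfolding compact_def by meson
  define g where "g = f \<circ> r"
  have g: "g n \<in> V_space j a" "norm (g n) = 1" for n
    using f by (auto simp: g_def)
  have "(\<lambda>n. 1 / real (Suc n)) \<longlonglongrightarrow> 0"
    using LIMSEQ_inverse_real_of_nat by (simp add: inverse_eq_divide)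
  then have lim1: "(\<lambda>n. a (f n) (f n)) \<longlonglongrightarrow> 0"
    by (rule tendsto_sandwich[OF _ _ tendsto_const, rotated 2])
      (use f(3) a_nonneg in auto)
  have ag: "(\<lambda>n. a (g n) (g n)) \<longlonglongrightarrow> 0"
    using LIMSEQ_subseq_LIMSEQ[OF lim1 r] by (simp add: g_def o_def)
  have jg: "Cauchy (\<lambda>n. j (g n))"
    using l by (intro LIMSEQ_imp_Cauchy[of _ l]) (simp add: g_def o_def)
  \<comment> \<open>By \<open>norm_X\<close> it is enough to control differences in
    \<open>O\<close>, where the sequence converges, and in \<open>a\<close>, where
    \<open>a_diff_le\<close> applies; the squared bounds \<open>e\<^sup>2 / 4\<close> and
    \<open>e\<^sup>2 / 2\<close> add up to less than \<open>e\<^sup>2\<close>.\<close>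
  have "Cauchy g"
  proof (rule CauchyI)
    fix e :: real assume e: "e > 0"
    obtain M1 where M1: "\<And>m n. m \<ge> M1 \<Longrightarrow> n \<ge> M1 \<Longrightarrow> norm (j (g m) - j (g n)) < e / 2"
      using CauchyD[OF jg, of "e / 2"] e by auto
    obtain M2 where M2: "\<And>n. n \<ge> M2 \<Longrightarrow> norm (a (g n) (g n) - 0) < e\<^sup>2 / 8"
      using LIMSEQ_D[OF ag, of "e\<^sup>2 / 8"] e by auto
    show "\<exists>M. \<forall>m\<ge>M. \<forall>n\<ge>M. norm (g m - g n) < e"
    proof (intro exI allI impI)
      fix m n assume mn: "m \<ge> max M1 M2" "n \<ge> max M1 M2"
      have "(norm (j (g m - g n)))\<^sup>2 < (e / 2)\<^sup>2"
        using M1[of m n] mn by (intro power_strict_mono) (auto simp: j_simps)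
      also have "\<dots> = e\<^sup>2 / 4" by (simp add: power_divide)
      finally have "(norm (j (g m - g n)))\<^sup>2 < e\<^sup>2 / 4" .
      moreover have "a (g m - g n) (g m - g n) < e\<^sup>2 / 2"
        using a_diff_le[of "g m" "g n"] M2[of m] M2[of n] mn by auto
      ultimately have "(norm (g m - g n))\<^sup>2 < e\<^sup>2"
        unfolding norm_X using zero_le_power2[of e] by linarith
      then show "norm (g m - g n) < e"
        by (rule power2_less_imp_less) (use e in simp)
    qed
  qed
  then obtain v where v: "g \<longlonglongrightarrow> v"
    using Cauchy_convergent_iff convergent_def by blast
  have "v \<in> V_space j a"
    by (rule closed_sequentially[OF closed_V _ v]) (rule g)
  moreover have "a v v = 0"
    using LIMSEQ_unique[OF ag bounded_bilinear.tendsto[OF a_bounded_bilinear v v]] by simp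
  ultimately have "v = 0"
    using V_Int_W W_space_iff by blast
  moreover have "norm v = 1"
    using LIMSEQ_unique[OF tendsto_norm[OF v]] g by simp
  ultimately show False by simp
qed

end

section \<open>The two components of the added vector\<close>

lemma ex_unit_W_orthogonal:
  assumes "hilbert_setting j a" "\<not> fin_dim (W_space a)" "fin_dim Y"
  obtains w where "w \<in> W_space a" "norm (j w) = 1" "\<And>y. y \<in> Y \<Longrightarrow> j w \<bullet> j y = 0"
proof -
  interpret hilbert_setting j a by fact
  obtain w where w: "w \<in> W_space a" "w \<noteq> 0" "\<And>y. y \<in> Y \<Longrightarrow> j w \<bullet> j y = 0"
    by (rule ex_nonzero_common_kernel[OF subspace_W assms(2,3), of "\<lambda>u v. j u \<bullet> j v"])
      (auto intro!: linearI simp: j_simps inner_simps)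
  have "j w \<noteq> 0" using w(2) inj_eq[OF j_inj, of w 0] by (simp add: j_simps)
  then show ?thesis using w
    by (intro that[of "(1 / norm (j w)) *\<^sub>R w"])
      (auto simp: j_simps subspace_scale[OF subspace_W])
qed

text \<open>Normalising by \<open>a\<close> is possible because \<open>a\<close> is definite on
  \<open>V\<close>, which meets \<open>W\<close> only in 0.\<close>

lemma ex_unit_V_a_orthogonal:
  assumes "hilbert_setting j a" "\<not> fin_dim (V_space j a)" "fin_dim Y"
  obtains z where "z \<in> V_space j a" "a z z = 1" "\<And>y. y \<in> Y \<Longrightarrow> a z y = 0"
proof -
  interpret hilbert_setting j a by fact
  obtain z where z: "z \<in> V_space j a" "z \<noteq> 0" "\<And>y. y \<in> Y \<Longrightarrow> a z y = 0"
    by (rule ex_nonzero_common_kernel[OF subspace_V assms(2,3) linear_a_left linear_a_right])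
      blast
  have "a z z > 0"
    using z V_Int_W W_space_iff a_nonneg[of z] by fastforce
  then show ?thesis using z
    by (intro that[of "(1 / sqrt (a z z)) *\<^sub>R z"])
      (auto simp: a_simps subspace_scale[OF subspace_V])
qed

section \<open>The augmented spaces\<close>

theorem proposition21:
  fixes j :: "'x::{real_inner,complete_space} \<Rightarrow> 'o::{real_inner,complete_space}"
    and a :: "'x \<Rightarrow> 'x \<Rightarrow> real"
    and X :: "nat \<Rightarrow> 'x set"
  assumes "hilbert_setting j a"
    and "\<not> fin_dim (W_space a)"
    and "\<not> fin_dim (V_space j a)"
    and "\<And>n. subspace (X n)"
    and "\<And>n. fin_dim (X n)"
    and "AS X"
    and "DF j a X"
  shows "\<exists>u :: nat \<Rightarrow> 'x. (\<forall>n. u n \<notin> X n) \<and>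
    AS (\<lambda>n. augment (X n) (u n)) \<and>
    DF j a (\<lambda>n. augment (X n) (u n)) \<and>
    \<not> DC j a (\<lambda>n. augment (X n) (u n))"
proof -
  interpret hilbert_setting j a by fact
  obtain P where P: "P > 0" "\<And>v. v \<in> V_space j a \<Longrightarrow> (norm (j v))\<^sup>2 \<le> P * a v v"
    using poincare_V by blast
  obtain C where C: "C > 0" "\<And>n v. v \<in> discrete_V j a (X n) \<Longrightarrow> (norm (j v))\<^sup>2 \<le> C * a v v"
    using assms(7) unfolding DF_def by blast
  have "\<exists>w. w \<in> W_space a \<and> norm (j w) = 1 \<and> (\<forall>y\<in>X n. j w \<bullet> j y = 0)" for n
    using ex_unit_W_orthogonal[OF assms(1,2) assms(5)[of n]] by metis
  then obtain w where w: "\<And>n. w n \<in> W_space a" "\<And>n. norm (j (w n)) = 1"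
      "\<And>n y. y \<in> X n \<Longrightarrow> j (w n) \<bullet> j y = 0"
    by metis
  have "\<exists>z. z \<in> V_space j a \<and> a z z = 1 \<and> (\<forall>y\<in>X n. a z y = 0)" for n
    using ex_unit_V_a_orthogonal[OF assms(1,3) assms(5)[of n]] by metis
  then obtain z where z: "\<And>n. z n \<in> V_space j a" "\<And>n. a (z n) (z n) = 1"
      "\<And>n y. y \<in> X n \<Longrightarrow> a (z n) y = 0"
    by metis
  define u where "u = (\<lambda>n. w n + z n)"
  have zw: "j (z n) \<bullet> j (w n) = 0" "j (w n) \<bullet> j (z n) = 0" for n
    using V_inner_W[OF z(1) w(1)] by (simp_all add: inner_commute)
  have uw: "j (u n) \<bullet> j (w n) = 1" for n
    using w(2)[of n] zw by (simp add: u_def j_simps inner_add_left flip: power2_norm_eq_inner)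
  have norm_ju: "(norm (j (u n)))\<^sup>2 \<le> 1 + P" for n
  proof -
    have "(norm (j (u n)))\<^sup>2 = (norm (j (w n)))\<^sup>2 + (norm (j (z n)))\<^sup>2"
      using zw by (simp add: u_def j_simps power2_norm_eq_inner inner_add_left inner_add_right)
    then show ?thesis using P(2)[OF z(1)[of n]] w z by simp
  qed
  have a_uz: "a (u n) (z n) = 1" for n
    using z(2) a_W[OF w(1)] by (simp add: u_def a_simps)
  have a_uu: "a (u n) (u n) = 1" for n
    using z(2) a_W[OF w(1)] by (simp add: u_def a_simps)
  have a_xz: "a x (z n) = 0" if "x \<in> X n" for x n
    using z(3)[OF that] a_sym by simp
  have a_xu: "a x (u n) = 0" "a (u n) x = 0" if "x \<in> X n" for x n
    using a_xz[OF that] z(3)[OF that] a_W[OF w(1)] by (auto simp: u_def a_simps)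
  have notin: "u n \<notin> X n" for n
    using a_xu(1)[of "u n" n] a_uu[of n] by auto
  have u_perp: "j (u n) \<bullet> j y = 0" if "y \<in> discrete_W a (X n)" for n y
    using that w(3) V_inner_W[OF z(1)]
    by (simp add: discrete_W_def u_def j_simps inner_add_left)
  \<comment> \<open>Pairing with \<open>z n\<close> under \<open>a\<close> reads off the coefficient
    of \<open>u n\<close>, and this pairing is zero on \<open>W\<close>.\<close>
  have dW: "discrete_W a (augment (X n) (u n)) \<subseteq> discrete_W a (X n)" for n
  proof
    fix y assume y: "y \<in> discrete_W a (augment (X n) (u n))"
    then obtain x t where xt: "x \<in> X n" "y = x + t *\<^sub>R u n"
      by (auto simp: discrete_W_def augment_def)
    have "a y (z n) = t"
      using a_xz[OF xt(1)] a_uz by (simp add: xt a_simps)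
    then have "t = 0" using a_W y by (simp add: discrete_W_def)
    then show "y \<in> discrete_W a (X n)" using xt y by (simp add: discrete_W_def)
  qed
  have AS: "AS (\<lambda>n. augment (X n) (u n))"
  proof (rule AS_mono[OF assms(6)])
    show "X n \<noteq> {}" for n using subspace_0[OF assms(4)[of n]] by blast
  qed (rule subset_augment)
  have DF: "DF j a (\<lambda>n. augment (X n) (u n))"
    unfolding DF_def
  \<comment> \<open>The 2 comes from splitting the square of a sum, \<open>C\<close> bounds the part
    in \<open>X n\<close>, and \<open>1 + P\<close> bounds the squared norm of \<open>u n\<close> in
    \<open>O\<close>.\<close>
  proof (intro exI[of _ "2 * (C + (1 + P))"] conjI allI ballI)
    show "0 < 2 * (C + (1 + P))" using C P by simp
    fix n v assume v: "v \<in> discrete_V j a (augment (X n) (u n))"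
    then obtain x t where xt: "x \<in> X n" "v = x + t *\<^sub>R u n"
      by (auto simp: discrete_V_def augment_def)
    \<comment> \<open>Removing the multiple of \<open>u n\<close> preserves orthogonality to the old
      kernel, since \<open>u n\<close> is itself orthogonal to it.\<close>
    have "j x \<bullet> j y = 0" if y: "y \<in> discrete_W a (X n)" for y
    proof -
      have "y \<in> discrete_W a (augment (X n) (u n))"
        using y subset_augment by (auto simp: discrete_W_def)
      then have "j v \<bullet> j y = 0" using v by (simp add: discrete_V_def)
      then show ?thesis using u_perp[OF y] by (simp add: xt j_simps inner_add_left)
    qed
    then have "x \<in> discrete_V j a (X n)" using xt by (simp add: discrete_V_def)
    then have x: "(norm (j x))\<^sup>2 \<le> C * a x x" by (rule C)
    have "0 \<le> (norm (j x - t *\<^sub>R j (u n)))\<^sup>2" by simp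
    then have "(norm (j v))\<^sup>2 \<le> 2 * (norm (j x))\<^sup>2 + 2 * (t\<^sup>2 * (norm (j (u n)))\<^sup>2)"
      unfolding xt power2_norm_eq_inner j_simps
      by (simp add: inner_simps inner_commute power2_eq_square algebra_simps)
    also have "\<dots> \<le> 2 * (C * a x x) + 2 * (t\<^sup>2 * (1 + P))"
      using x norm_ju[of n] by (intro add_mono mult_left_mono) auto
    also have "\<dots> \<le> 2 * (C + (1 + P)) * (a x x + t\<^sup>2)"
      using C(1) P(1) a_nonneg[of x] by (simp add: algebra_simps)
    also have "a x x + t\<^sup>2 = a v v"
      using a_xu[OF xt(1)] a_uu by (simp add: xt a_simps power2_eq_square)
    finally show "(norm (j v))\<^sup>2 \<le> 2 * (C + (1 + P)) * a v v" .
  qed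
  have "\<not> DC j a (\<lambda>n. augment (X n) (u n))"
  proof
    assume DC: "DC j a (\<lambda>n. augment (X n) (u n))"
    have "u n \<in> augment (X n) (u n)" for n
      using subspace_0[OF assms(4)[of n]] unfolding augment_def
      by (force intro: exI[of _ "1::real"])
    \<comment> \<open>By \<open>dW\<close> only the old kernel has to be tested, so the added
      vectors themselves can refute DC, with all of the naturals as index set.\<close>
    then have "u n \<in> discrete_V j a (augment (X n) (u n))" for n
      using dW u_perp unfolding discrete_V_def by blast
    moreover have "bounded (u ` UNIV)"
    proof -
      have "norm (u n) \<le> sqrt (2 + P)" for n
        using norm_X[of "u n"] norm_ju[of n] a_uu[of n] by (intro real_le_rsqrt) simp
      then show ?thesis unfolding bounded_iff by blast
    qed
    ultimately obtain r v where v: "v \<in> V_space j a" and lim: "(\<lambda>k. j (u (r k))) \<longlonglongrightarrow> j v"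
      using DC unfolding DC_def by (metis infinite_UNIV_nat)
    \<comment> \<open>The unit vector \<open>j (w (r k))\<close> detects \<open>u (r k)\<close> but
      not \<open>v\<close>; Cauchy-Schwarz then keeps them at distance at least 1.\<close>
    have "1 \<le> norm (j (u (r k)) - j v)" for k
    proof -
      have "1 = (j (u (r k)) - j v) \<bullet> j (w (r k))"
        using uw V_inner_W[OF v w(1)] by (simp add: inner_diff_left)
      also have "\<dots> \<le> norm (j (u (r k)) - j v)"
        using norm_cauchy_schwarz[of _ "j (w (r k))"] w(2) by (metis mult.right_neutral)
      finally show ?thesis .
    qed
    then show False
      using LIMSEQ_D[OF lim, of 1] by (meson le_refl not_le zero_less_one)
  qed
  with notin AS DF show ?thesis by blast
qed

end
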